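(* Let $n\ge1$ and $d\ge2$. For generic $q\in\mathscr{P}_d$, writing $Y=Z(q)\subseteq\mathbb{R}^n$ (and assuming $Y\ne\varnothing$), for every $x\in\mathbb{R}^n$ the set $B(x,\mathrm{dist}_Y(x))\cap Y$ is a nondegenerate simplex with at most $n+1$ points (i.e. it is a finite set of at most $n+1$ affinely independent points). In particular, $m_Y\le n+1$.
   Context: $\mathscr{P}_d$ is the finite-dimensional vector space of real polynomials on $\mathbb{R}^n$ of degree at most $d$; "generic" means for all elements of a residual subset of $\mathscr{P}_d$ (one containing a countable intersection of open dense subsets). $Z(q)$ is the real zero set of $q$. $\mathrm{dist}_Y(x)=\min_{y\in Y}\|x-y\|$; $B(x,r)$ is the closed Euclidean ball of radius $r$ centered at $x$; $m_Y(x)=\#(B(x,\mathrm{dist}_Y(x))\cap Y)$. *)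

theory Defs
  imports "HOL-Analysis.Analysis" "HOL-Library.Poly_Mapping"
begin

(* A polynomial in the variables indexed by 'n is a finitely supported map from monomials to
   coefficients; a monomial is the finitely supported map of its exponents. *)
type_synonym 'n rpoly = "('n \<Rightarrow>\<^sub>0 nat) \<Rightarrow>\<^sub>0 real"

definition mono_degree :: "('n::finite \<Rightarrow>\<^sub>0 nat) \<Rightarrow> nat" where
  "mono_degree m = (\<Sum>i\<in>UNIV. Poly_Mapping.lookup m i)"

definition poly_eval :: "('n::finite) rpoly \<Rightarrow> real ^ 'n \<Rightarrow> real" where
  "poly_eval q x = (\<Sum>m\<in>Poly_Mapping.keys q. Poly_Mapping.lookup q m * (\<Prod>i\<in>UNIV. (x $ i) ^ Poly_Mapping.lookup m i))"

definition poly_space :: "nat \<Rightarrow> ('n::finite) rpoly set" where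
  "poly_space d = {q. \<forall>m\<in>Poly_Mapping.keys q. mono_degree m \<le> d}"

(* The coarsest topology making all coefficients continuous (the topology on functions is the
   product topology). As only finitely many monomials have degree at most d, this is the usual
   topology of a finite-dimensional real vector space. *)
definition poly_topology :: "nat \<Rightarrow> ('n::finite) rpoly topology" where
  "poly_topology d = pullback_topology (poly_space d) Poly_Mapping.lookup euclidean"

definition residual_in :: "'a topology \<Rightarrow> 'a set \<Rightarrow> bool" where
  "residual_in X S \<longleftrightarrow> S \<subseteq> topspace X \<and>
     (\<exists>\<U>. countable \<U> \<and> (\<forall>U\<in>\<U>. openin X U \<and> X closure_of U = topspace X) \<and>
          topspace X \<inter> \<Inter>\<U> \<subseteq> S)"

definition generically :: "nat \<Rightarrow> (('n::finite) rpoly \<Rightarrow> bool) \<Rightarrow> bool" where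
  "generically d P \<longleftrightarrow> residual_in (poly_topology d) {q \<in> poly_space d. P q}"

definition zero_set :: "('n::finite) rpoly \<Rightarrow> (real ^ 'n) set" where
  "zero_set q = {x. poly_eval q x = 0}"

(* For nonempty closed Y (such as a nonempty zero set) the infimum infdist x Y is a minimum. *)
definition nearest_points :: "'a::metric_space set \<Rightarrow> 'a \<Rightarrow> 'a set" where
  "nearest_points Y x = cball x (infdist x Y) \<inter> Y"

(* Meaningful when nearest_points Y x is finite, since card of an infinite set is 0. *)
definition num_nearest :: "'a::metric_space set \<Rightarrow> 'a \<Rightarrow> nat" where
  "num_nearest Y x = card (nearest_points Y x)"

lemma topspace_poly_topology: "topspace (poly_topology d) = poly_space d"
  by (simp add: poly_topology_def topspace_pullback_topology)

lemma closed_zero_set: "closed (zero_set q)"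
proof -
  have "continuous_on UNIV (poly_eval q)"
    unfolding poly_eval_def by (intro continuous_intros)
  then have "closed (poly_eval q -` {0})"
    by (intro closed_vimage) auto
  then show ?thesis
    by (simp add: zero_set_def vimage_def)
qed

lemma nearest_points_zero_set_nonempty:
  assumes "zero_set q \<noteq> {}"
  shows "nearest_points (zero_set q) x \<noteq> {}"
proof -
  obtain y where "y \<in> zero_set q" "infdist x (zero_set q) = dist x y"
    using infdist_attains_inf[OF closed_zero_set assms] by blast
  then show ?thesis by (auto simp: nearest_points_def)
qed

end

theory Submission
  imports Defs "HOL-Computational_Algebra.Polynomial"
begin

text \<open>
  If no integer polynomial in the coefficients of \<open>q\<close> vanishes at \<open>q\<close> without vanishing identically
  on \<open>poly_space d\<close>, which is a residual condition, then for every \<open>h \<in> poly_space d\<close> there is a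
  derivation \<open>D\<close> of the field of reals sending each coefficient of \<open>q\<close> to that of \<open>h\<close>. Applying \<open>D\<close>
  to \<open>q(y) = 0\<close> gives \<open>h(y) + \<nabla>q(y) \<bullet> Dy = 0\<close>, so the algebra of derivations replaces
  transversality. Taking \<open>h = 1\<close> shows that \<open>\<nabla>q\<close> does not vanish on the zero set. Taking
  \<open>h(z) = \<nabla>q(z) \<bullet> Bz\<close> for a matrix \<open>B\<close> shows that \<open>Dy + By\<close> is tangent to the zero set, hence
  orthogonal to \<open>y - x\<close> if \<open>y\<close> is a nearest point to \<open>x\<close>. Combined with \<open>D\<close> applied to
  \<open>|y - x|\<^sup>2 = r\<^sup>2\<close> this makes \<open>(y - x) \<bullet> By\<close> an affine function of \<open>y\<close> on the set of nearest points.
  Consequently every affine dependence between nearest points annihilates all quadratic polynomials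
  as well, which is impossible for a minimal dependence.
\<close>

section \<open>Extending derivations of a field\<close>

definition derivation :: "('a::comm_ring_1 \<Rightarrow> 'a) \<Rightarrow> bool" where
  "derivation D \<longleftrightarrow> (\<forall>a b. D (a + b) = D a + D b) \<and> (\<forall>a b. D (a * b) = a * D b + D a * b)"

text \<open>The graph of a derivation defined on a subring. As a relation it is extended by
  inclusion, which suits Zorn's lemma; closure under differences lets the last clause express
  single-valuedness.\<close>

definition derivation_graph :: "('a::comm_ring_1 \<times> 'a) set \<Rightarrow> bool" where
  "derivation_graph G \<longleftrightarrow> (1, 0) \<in> G \<and>
     (\<forall>a a' b b'. (a, a') \<in> G \<longrightarrow> (b, b') \<in> G \<longrightarrow>
        (a - b, a' - b') \<in> G \<and> (a * b, a * b' + a' * b) \<in> G) \<and>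
     (\<forall>c. (0, c) \<in> G \<longrightarrow> c = 0)"

lemma
  assumes "derivation_graph G"
  shows derivation_graph_one: "(1, 0) \<in> G"
    and derivation_graph_diff: "(a, a') \<in> G \<Longrightarrow> (b, b') \<in> G \<Longrightarrow> (a - b, a' - b') \<in> G"
    and derivation_graph_mult: "(a, a') \<in> G \<Longrightarrow> (b, b') \<in> G \<Longrightarrow> (a * b, a * b' + a' * b) \<in> G"
    and derivation_graph_0D: "(0, c) \<in> G \<Longrightarrow> c = 0"
  using assms unfolding derivation_graph_def by blast+

lemma derivation_graph_zero:
  assumes "derivation_graph G"
  shows "(0, 0) \<in> G"
  using derivation_graph_diff[OF assms derivation_graph_one[OF assms] derivation_graph_one[OF assms]]
  by simp

lemma derivation_graph_add:
  assumes G: "derivation_graph G" and "(a, a') \<in> G" "(b, b') \<in> G"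
  shows "(a + b, a' + b') \<in> G"
proof -
  have "(0 - b, 0 - b') \<in> G"
    by (rule derivation_graph_diff[OF G derivation_graph_zero[OF G] assms(3)])
  from derivation_graph_diff[OF G assms(2) this] show ?thesis by simp
qed

lemma derivation_graph_sum:
  assumes G: "derivation_graph G" and "\<And>i. i \<in> I \<Longrightarrow> (f i, g i) \<in> G"
  shows "(sum f I, sum g I) \<in> G"
  using assms(2)
  by (induction I rule: infinite_finite_induct)
     (auto intro: derivation_graph_add[OF G] derivation_graph_zero[OF G])

lemma derivation_graph_unique:
  assumes G: "derivation_graph G" and "(a, b) \<in> G" "(a, c) \<in> G"
  shows "b = c"
  using derivation_graph_0D[OF G, of "b - c"] derivation_graph_diff[OF G assms(2,3)] by simp

text \<open>Polynomials over the domain of the partial derivation, each paired with its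
  coefficientwise image.\<close>

definition graph_polys :: "('a::comm_ring_1 \<times> 'a) set \<Rightarrow> ('a poly \<times> 'a poly) set" where
  "graph_polys G = {(p, r). \<forall>k. (coeff p k, coeff r k) \<in> G}"

lemma graph_polys_diff:
  assumes "derivation_graph G" "(p, r) \<in> graph_polys G" "(p', r') \<in> graph_polys G"
  shows "(p - p', r - r') \<in> graph_polys G"
  using assms by (auto simp: graph_polys_def intro: derivation_graph_diff)

lemma graph_polys_mult:
  assumes G: "derivation_graph G" and "(p, r) \<in> graph_polys G" "(p', r') \<in> graph_polys G"
  shows "(p * p', p * r' + r * p') \<in> graph_polys G"
proof -
  have "(coeff (p * p') n, coeff (p * r' + r * p') n) \<in> G" for n
    unfolding coeff_add coeff_mult sum.distrib[symmetric]
    using assms(2,3)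
    by (intro derivation_graph_sum[OF G] derivation_graph_mult[OF G]) (auto simp: graph_polys_def)
  then show ?thesis by (simp add: graph_polys_def)
qed

lemma graph_polys_monom:
  assumes "derivation_graph G" "(a, a') \<in> G"
  shows "(monom a n, monom a' n) \<in> graph_polys G"
  using assms by (auto simp: graph_polys_def derivation_graph_zero)

text \<open>The value that any derivation sending \<open>x\<close> to \<open>c\<close> must take at
  \<open>poly p x\<close>, when \<open>r\<close> carries the derivatives of the coefficients of
  \<open>p\<close>.\<close>

definition value_at :: "'a::idom \<Rightarrow> 'a \<Rightarrow> 'a poly \<Rightarrow> 'a poly \<Rightarrow> 'a" where
  "value_at x c p r = poly r x + poly (pderiv p) x * c"

lemma value_at_mult:
  "value_at x c (p * p') (p * r' + r * p') = poly p x * value_at x c p' r' + value_at x c p r * poly p' x"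
  by (simp add: value_at_def pderiv_mult algebra_simps)

lemma value_at_diff:
  "value_at x c (p - p') (r - r') = value_at x c p r - value_at x c p' r'"
  by (simp add: value_at_def pderiv_diff algebra_simps)

text \<open>The value at \<open>x\<close> is forced by a polynomial of least degree annihilating \<open>x\<close>, and is
  consistent with all other such polynomials by pseudo-division.\<close>

lemma derivation_graph_adjoin_value:
  fixes G :: "('a::field_char_0 \<times> 'a) set"
  assumes G: "derivation_graph G"
  obtains c where "\<And>p r. (p, r) \<in> graph_polys G \<Longrightarrow> poly p x = 0 \<Longrightarrow> value_at x c p r = 0"
proof -
  have zero: "r = 0" if "(0, r) \<in> graph_polys G" for r
    using that derivation_graph_0D[OF G] by (auto simp: graph_polys_def intro!: poly_eqI)
  define A where "A = {(p, r). (p, r) \<in> graph_polys G \<and> p \<noteq> 0 \<and> poly p x = 0}"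
  show thesis
  proof (cases "A = {}")
    case True
    \<comment> \<open>Here \<open>x\<close> is transcendental over the domain, so the choice of
      \<open>c\<close> is free and 0 is taken.\<close>
    have "value_at x 0 p r = 0" if "(p, r) \<in> graph_polys G" "poly p x = 0" for p r
    proof -
      have "p = 0" using that True by (auto simp: A_def)
      then show ?thesis using zero[of r] that(1) by (simp add: value_at_def)
    qed
    then show thesis by (rule that)
  next
    case False
    then obtain p0 r0 where A0: "(p0, r0) \<in> A"
      and least: "\<And>p r. (p, r) \<in> A \<Longrightarrow> degree p0 \<le> degree p"
      using arg_min_nat_lemma[of "\<lambda>z. z \<in> A" _ "\<lambda>z. degree (fst z)"]
      by (metis ex_in_conv fst_conv surj_pair)
    have p0: "(p0, r0) \<in> graph_polys G" "p0 \<noteq> 0" "poly p0 x = 0"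
      using A0 by (auto simp: A_def)
    have deg: "degree p0 > 0"
      using p0(2,3) by (auto elim!: degree_eq_zeroE intro!: gr0I)
    \<comment> \<open>Natural numbers have derivative 0, so formal differentiation stays within
      \<open>graph_polys G\<close>.\<close>
    have "(pderiv p0, pderiv r0) \<in> graph_polys G"
    proof -
      have "(of_nat k :: 'a, 0) \<in> G" for k
        by (induction k)
           (use derivation_graph_add[OF G derivation_graph_one[OF G]] derivation_graph_zero[OF G] in
             \<open>force simp: add.commute\<close>)+
      from derivation_graph_mult[OF G this] show ?thesis
        using p0(1) by (auto simp: graph_polys_def coeff_pderiv simp del: of_nat_Suc)
    qed
    moreover have "pderiv p0 \<noteq> 0" using deg by (simp add: pderiv_eq_0_iff)
    moreover have "degree (pderiv p0) < degree p0" using deg by (simp add: degree_pderiv)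
    \<comment> \<open>In characteristic 0 the polynomial \<open>pderiv p0\<close> is nonzero of
      smaller degree, so by minimality \<open>x\<close> is a simple root of
      \<open>p0\<close>.\<close>
    ultimately have nz: "poly (pderiv p0) x \<noteq> 0"
      using least[of "pderiv p0" "pderiv r0"] by (auto simp: A_def)
    \<comment> \<open>The unique solution of \<open>value_at x c p0 r0 = 0\<close>.\<close>
    define c where "c = - poly r0 x / poly (pderiv p0) x"
    have v0: "value_at x c p0 r0 = 0" using nz by (simp add: value_at_def c_def)
    have "value_at x c p r = 0" if "(p, r) \<in> graph_polys G" "poly p x = 0" for p r
      using that
    proof (induction "degree p" arbitrary: p r rule: less_induct)
      case less
      show ?case
      proof (cases "p = 0")
        case True
        then show ?thesis using zero[of r] less.prems(1) by (simp add: value_at_def)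
      next
        case False
        then have le: "degree p0 \<le> degree p" using least less.prems by (auto simp: A_def)
        define k where "k = degree p - degree p0"
        define a where "a = lead_coeff p0"
        define a' where "a' = coeff r0 (degree p0)"
        define b where "b = lead_coeff p"
        define b' where "b' = coeff r (degree p)"
        have ab: "(a, a') \<in> G" "(b, b') \<in> G"
          using p0(1) less.prems(1) by (auto simp: graph_polys_def a_def a'_def b_def b'_def)
        have "a \<noteq> 0" "b \<noteq> 0" using p0(2) False by (auto simp: a_def b_def)
        \<comment> \<open>One step of pseudo-division by \<open>p0\<close>: the leading terms cancel
          without inverting \<open>a\<close>, which need not be possible in the domain. The
          companion \<open>r1\<close> follows by the Leibniz rule.\<close>
        define p1 where "p1 = monom a 0 * p - monom b k * p0"
        define r1 where "r1 = (monom a 0 * r + monom a' 0 * p) - (monom b k * r0 + monom b' k * p0)"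
        have "(p1, r1) \<in> graph_polys G"
          unfolding p1_def r1_def
          by (intro graph_polys_diff[OF G] graph_polys_mult[OF G] graph_polys_monom[OF G] ab
                less.prems(1) p0(1))
        moreover have "poly p1 x = 0" using less.prems(2) p0(3) by (simp add: p1_def)
        moreover have "p1 = 0 \<or> degree p1 < degree p"
        proof -
          have "degree (monom a 0 * p) = degree p" "degree (monom b k * p0) = degree p"
            using \<open>a \<noteq> 0\<close> \<open>b \<noteq> 0\<close> False p0(2) le
            by (simp_all add: degree_mult_eq degree_monom_eq k_def)
          then have "degree p1 \<le> degree p" unfolding p1_def by (intro degree_diff_le) auto
          moreover have "coeff p1 (degree p) = 0"
            using le by (simp add: p1_def coeff_monom_mult k_def a_def b_def)
          ultimately show ?thesis
            by (metis le_neq_implies_less leading_coeff_0_iff)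
        qed
        ultimately have "value_at x c p1 r1 = 0"
          using less.hyps[of p1 r1] zero[of r1] by (cases "p1 = 0") (auto simp: value_at_def)
        moreover have "value_at x c p1 r1 = a * value_at x c p r"
          unfolding p1_def r1_def value_at_diff value_at_mult
          by (simp add: v0 less.prems(2) p0(3) poly_monom)
        ultimately show ?thesis using \<open>a \<noteq> 0\<close> by simp
      qed
    qed
    then show thesis by (rule that)
  qed
qed

text \<open>The pairs of \<open>poly p x\<close> and \<open>value_at x c p r\<close> extend the
  derivation to the subring generated by \<open>x\<close>; the choice of \<open>c\<close> is what
  makes them single-valued.\<close>

lemma derivation_graph_adjoin:
  fixes G :: "('a::field_char_0 \<times> 'a) set"
  assumes G: "derivation_graph G"
  obtains H c where "derivation_graph H" "G \<subseteq> H" "(x, c) \<in> H"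
proof -
  obtain c where c: "\<And>p r. (p, r) \<in> graph_polys G \<Longrightarrow> poly p x = 0 \<Longrightarrow> value_at x c p r = 0"
    using derivation_graph_adjoin_value[OF G] by blast
  define H where "H = {(poly p x, value_at x c p r) | p r. (p, r) \<in> graph_polys G}"
  have const: "(a, a') \<in> H" if "(a, a') \<in> G" for a a'
    unfolding H_def using graph_polys_monom[OF G that, of 0]
    by (force simp: value_at_def pderiv_monom poly_monom)
  have "(x, c) \<in> H"
    unfolding H_def using graph_polys_monom[OF G derivation_graph_one[OF G], of 1]
    by (force simp: value_at_def pderiv_monom poly_monom)
  moreover have "derivation_graph H"
    unfolding derivation_graph_def
  proof (intro conjI allI impI)
    show "(1, 0) \<in> H" by (rule const[OF derivation_graph_one[OF G]])
  next
    fix a a' b b' assume "(a, a') \<in> H" "(b, b') \<in> H"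
    then obtain p r p' r' where *: "(p, r) \<in> graph_polys G" "(p', r') \<in> graph_polys G"
      "a = poly p x" "a' = value_at x c p r" "b = poly p' x" "b' = value_at x c p' r'"
      by (auto simp: H_def)
    show "(a - b, a' - b') \<in> H"
      unfolding H_def using graph_polys_diff[OF G *(1,2)] *(3-)
      by (force simp: value_at_diff)
    show "(a * b, a * b' + a' * b) \<in> H"
      unfolding H_def using graph_polys_mult[OF G *(1,2)] *(3-)
      by (force simp: value_at_mult)
  next
    fix e assume "(0, e) \<in> H"
    then show "e = 0" using c by (auto simp: H_def)
  qed
  moreover have "G \<subseteq> H" using const by auto
  ultimately show thesis using that by blast
qed

text \<open>Adjoining an element cannot enlarge a maximal derivation graph, so such a graph, given
  by Zorn's lemma, is defined everywhere.\<close>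

lemma derivation_graph_extends:
  fixes G :: "('a::field_char_0 \<times> 'a) set"
  assumes G: "derivation_graph G"
  obtains D where "derivation D" "\<And>a b. (a, b) \<in> G \<Longrightarrow> D a = b"
proof -
  have "\<exists>M\<in>{H. derivation_graph H \<and> G \<subseteq> H}. \<forall>X\<in>{H. derivation_graph H \<and> G \<subseteq> H}. M \<subseteq> X \<longrightarrow> X = M"
  proof (rule subset_Zorn_nonempty)
    show "{H. derivation_graph H \<and> G \<subseteq> H} \<noteq> {}" using G by auto
  next
    fix C assume C: "C \<noteq> {}" "subset.chain {H. derivation_graph H \<and> G \<subseteq> H} C"
    have mem: "derivation_graph H" "G \<subseteq> H" if "H \<in> C" for H
      using C(2) that by (auto simp: subset.chain_def)
    have "derivation_graph (\<Union>C)"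
      unfolding derivation_graph_def
    proof (intro conjI allI impI)
      show "(1, 0) \<in> \<Union>C" using C(1) mem derivation_graph_one by blast
    next
      fix a a' b b' assume "(a, a') \<in> \<Union>C" "(b, b') \<in> \<Union>C"
      then obtain H where H: "H \<in> C" "(a, a') \<in> H" "(b, b') \<in> H"
        using C(2) by (auto simp: subset_chain_def) blast
      show "(a - b, a' - b') \<in> \<Union>C" "(a * b, a * b' + a' * b) \<in> \<Union>C"
        using derivation_graph_diff[OF mem(1)[OF H(1)] H(2,3)]
          derivation_graph_mult[OF mem(1)[OF H(1)] H(2,3)] H(1) by blast+
    next
      fix e assume "(0, e) \<in> \<Union>C"
      then show "e = 0" using mem derivation_graph_0D by blast
    qed
    then show "\<Union>C \<in> {H. derivation_graph H \<and> G \<subseteq> H}" using C(1) mem(2) by blast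
  qed
  then obtain M where M: "derivation_graph M" "G \<subseteq> M"
    and max: "\<And>H. derivation_graph H \<Longrightarrow> M \<subseteq> H \<Longrightarrow> H = M"
    by (auto; metis subset_trans)
  have "\<exists>c. (x, c) \<in> M" for x
  proof -
    obtain H c where "derivation_graph H" "M \<subseteq> H" "(x, c) \<in> H"
      using derivation_graph_adjoin[OF M(1)] by blast
    then show ?thesis using max by blast
  qed
  then obtain D where D: "\<And>x. (x, D x) \<in> M" by metis
  have eq: "D a = b" if "(a, b) \<in> M" for a b
    using derivation_graph_unique[OF M(1) D that] .
  have "derivation D"
    unfolding derivation_def using D
    by (auto intro!: eq derivation_graph_add[OF M(1)] derivation_graph_mult[OF M(1)])
  then show thesis using that eq M(2) by blast
qed

section \<open>Differentiation rules for a derivation\<close>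

lemma
  assumes D: "derivation D"
  shows derivation_add: "D (a + b) = D a + D b"
    and derivation_mult: "D (a * b) = a * D b + D a * b"
    and derivation_0: "D 0 = 0"
    and derivation_1: "D 1 = 0"
  using D unfolding derivation_def by (blast, blast, metis add_cancel_right_right add.right_neutral,
    metis (no_types) add_cancel_right_right mult_1 mult.right_neutral)

lemma derivation_diff:
  assumes "derivation D"
  shows "D (a - b) = D a - D b"
  using derivation_add[OF assms, of "a - b" b] by (simp add: algebra_simps)

lemma derivation_sum:
  assumes "derivation D"
  shows "D (sum f I) = (\<Sum>i\<in>I. D (f i))"
  by (induction I rule: infinite_finite_induct) (simp_all add: derivation_0 derivation_add assms)

lemma derivation_power:
  assumes "derivation D"
  shows "D (a ^ n) = of_nat n * a ^ (n - 1) * D a"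
proof (induction n)
  case (Suc n)
  then show ?case
    by (cases n) (auto simp: derivation_mult[OF assms] algebra_simps)
qed (simp add: derivation_1 assms)

lemma derivation_prod:
  assumes "derivation D" "finite I"
  shows "D (prod f I) = (\<Sum>i\<in>I. D (f i) * prod f (I - {i}))"
  using assms(2)
proof (induction I rule: finite_induct)
  case (insert j I)
  have *: "prod f (insert j I - {i}) = f j * prod f (I - {i})" if "i \<in> I" for i
    using that insert.hyps by (subst insert_Diff_if) auto
  have "D (prod f (insert j I)) = f j * (\<Sum>i\<in>I. D (f i) * prod f (I - {i})) + D (f j) * prod f I"
    using insert by (simp add: derivation_mult[OF assms(1)])
  also have "\<dots> = (\<Sum>i\<in>insert j I. D (f i) * prod f (insert j I - {i}))"
    using insert.hyps by (simp add: * sum_distrib_left mult_ac)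
  finally show ?case .
qed (simp add: derivation_1 assms)

section \<open>Evaluation and gradient of polynomials\<close>

definition mono_eval :: "('n::finite \<Rightarrow>\<^sub>0 nat) \<Rightarrow> real ^ 'n \<Rightarrow> real" where
  "mono_eval m x = (\<Prod>i\<in>UNIV. (x $ i) ^ Poly_Mapping.lookup m i)"

text \<open>The truncated exponent at a zero power is harmless, since the factor in front of it is
  then 0.\<close>

definition mono_grad :: "('n::finite \<Rightarrow>\<^sub>0 nat) \<Rightarrow> real ^ 'n \<Rightarrow> real ^ 'n" where
  "mono_grad m x = (\<chi> i. of_nat (Poly_Mapping.lookup m i) * (x $ i) ^ (Poly_Mapping.lookup m i - 1) *
     (\<Prod>j\<in>UNIV - {i}. (x $ j) ^ Poly_Mapping.lookup m j))"

definition poly_grad :: "('n::finite) rpoly \<Rightarrow> real ^ 'n \<Rightarrow> real ^ 'n" where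
  "poly_grad q x = (\<Sum>m\<in>Poly_Mapping.keys q. Poly_Mapping.lookup q m *\<^sub>R mono_grad m x)"

lemma poly_eval_eq_sum:
  assumes "finite M" "Poly_Mapping.keys q \<subseteq> M"
  shows "poly_eval q x = (\<Sum>m\<in>M. Poly_Mapping.lookup q m * mono_eval m x)"
  unfolding poly_eval_def mono_eval_def[symmetric]
  using assms by (intro sum.mono_neutral_left) (auto simp: in_keys_iff)

lemma mono_eval_has_derivative:
  "(mono_eval m has_derivative (\<lambda>v. mono_grad m x \<bullet> v)) (at x)"
proof -
  have "((\<lambda>x. x $ i ^ k) has_derivative (\<lambda>v. of_nat k * x $ i ^ (k - 1) * v $ i)) (at x)"
    for i and k :: nat
    by (auto intro!: derivative_eq_intros bounded_linear_imp_has_derivative[OF bounded_linear_vec_nth] simp: mult_ac)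
  then have "((\<lambda>x. \<Prod>i\<in>UNIV. x $ i ^ Poly_Mapping.lookup m i) has_derivative
      (\<lambda>v. \<Sum>i\<in>UNIV. of_nat (Poly_Mapping.lookup m i) * x $ i ^ (Poly_Mapping.lookup m i - 1) * v $ i *
        (\<Prod>j\<in>UNIV - {i}. x $ j ^ Poly_Mapping.lookup m j))) (at x)"
    by (intro has_derivative_prod)
  then show ?thesis
    by (simp add: mono_eval_def[abs_def] mono_grad_def inner_vec_def mult_ac)
qed

lemma poly_eval_has_derivative:
  "(poly_eval q has_derivative (\<lambda>v. poly_grad q x \<bullet> v)) (at x)"
proof -
  have "((\<lambda>x. \<Sum>m\<in>Poly_Mapping.keys q. Poly_Mapping.lookup q m * mono_eval m x) has_derivative
      (\<lambda>v. \<Sum>m\<in>Poly_Mapping.keys q. Poly_Mapping.lookup q m * (mono_grad m x \<bullet> v))) (at x)"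
    by (intro has_derivative_sum has_derivative_mult_right mono_eval_has_derivative)
  moreover have "poly_eval q = (\<lambda>x. \<Sum>m\<in>Poly_Mapping.keys q. Poly_Mapping.lookup q m * mono_eval m x)"
    by (rule ext, rule poly_eval_eq_sum) auto
  ultimately show ?thesis by (simp add: poly_grad_def inner_sum_left)
qed

lemma derivation_mono_eval:
  assumes "derivation D"
  shows "D (mono_eval m x) = mono_grad m x \<bullet> (\<chi> i. D (x $ i))"
  by (simp add: mono_eval_def mono_grad_def inner_vec_def derivation_prod derivation_power assms mult_ac)

text \<open>The Leibniz rule splits into derivatives of the coefficients, which assemble to
  \<open>h\<close>, and derivatives of the coordinates, which pair with the gradient.\<close>

lemma derivation_poly_eval:
  assumes D: "derivation D" and h: "\<And>m. D (Poly_Mapping.lookup q m) = Poly_Mapping.lookup h m"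
  shows "D (poly_eval q x) = poly_eval h x + poly_grad q x \<bullet> (\<chi> i. D (x $ i))"
proof -
  have "Poly_Mapping.keys h \<subseteq> Poly_Mapping.keys q"
    using h derivation_0[OF D] by (metis in_keys_iff subsetI)
  then have "poly_eval h x = (\<Sum>m\<in>Poly_Mapping.keys q. Poly_Mapping.lookup h m * mono_eval m x)"
    by (intro poly_eval_eq_sum) auto
  moreover have "poly_eval q x = (\<Sum>m\<in>Poly_Mapping.keys q. Poly_Mapping.lookup q m * mono_eval m x)"
    by (intro poly_eval_eq_sum) auto
  ultimately show ?thesis
    by (simp add: derivation_sum[OF D] derivation_mult[OF D] h derivation_mono_eval[OF D]
        poly_grad_def inner_sum_left sum.distrib)
qed

section \<open>Arithmetic and degrees of polynomials\<close>

lemma poly_eval_zero: "poly_eval 0 x = 0"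
  by (simp add: poly_eval_def)

lemma poly_eval_add: "poly_eval (p + q) x = poly_eval p x + poly_eval q x"
proof -
  let ?M = "Poly_Mapping.keys p \<union> Poly_Mapping.keys q"
  have "poly_eval (p + q) x = (\<Sum>m\<in>?M. Poly_Mapping.lookup (p + q) m * mono_eval m x)"
    "poly_eval p x = (\<Sum>m\<in>?M. Poly_Mapping.lookup p m * mono_eval m x)"
    "poly_eval q x = (\<Sum>m\<in>?M. Poly_Mapping.lookup q m * mono_eval m x)"
    using keys_add[of p q] by (auto intro!: poly_eval_eq_sum)
  then show ?thesis by (simp add: lookup_add sum.distrib distrib_right)
qed

lemma poly_eval_sum: "poly_eval (sum f A) x = (\<Sum>a\<in>A. poly_eval (f a) x)"
  by (induction A rule: infinite_finite_induct) (simp_all add: poly_eval_zero poly_eval_add)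

lemma poly_eval_single: "poly_eval (Poly_Mapping.single m c) x = c * mono_eval m x"
  by (subst poly_eval_eq_sum[of "{m}"]) auto

lemma poly_space_iff: "q \<in> poly_space d \<longleftrightarrow> (\<forall>m. Poly_Mapping.lookup q m \<noteq> 0 \<longrightarrow> mono_degree m \<le> d)"
  by (auto simp: poly_space_def in_keys_iff)

lemma poly_space_sum:
  assumes "\<And>a. a \<in> A \<Longrightarrow> f a \<in> poly_space d"
  shows "sum f A \<in> poly_space d"
  using assms unfolding poly_space_iff lookup_sum by (metis sum.neutral)

lemma mono_eval_add: "mono_eval (m + m') x = mono_eval m x * mono_eval m' x"
  by (simp add: mono_eval_def lookup_add power_add prod.distrib)

lemma mono_degree_add: "mono_degree (m + m') = mono_degree m + mono_degree m'"
  by (simp add: mono_degree_def lookup_add sum.distrib)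

lemma mono_eval_single: "mono_eval (Poly_Mapping.single i 1) x = x $ i"
proof -
  have "mono_eval (Poly_Mapping.single i 1) x = (\<Prod>k\<in>UNIV. if k = i then x $ i else 1)"
    unfolding mono_eval_def by (intro prod.cong) (auto simp: lookup_single when_def)
  then show ?thesis by simp
qed

lemma mono_degree_single: "mono_degree (Poly_Mapping.single i k) = k"
  by (simp add: mono_degree_def lookup_single when_def)

lemma mono_grad_eq:
  "mono_grad (m + Poly_Mapping.single i 1) x $ i = of_nat (Suc (Poly_Mapping.lookup m i)) * mono_eval m x"
proof -
  have "(\<Prod>j\<in>UNIV - {i}. x $ j ^ Poly_Mapping.lookup (m + Poly_Mapping.single i 1) j) =
      (\<Prod>j\<in>UNIV - {i}. x $ j ^ Poly_Mapping.lookup m j)"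
    by (intro prod.cong) (auto simp: lookup_add lookup_single when_def)
  then show ?thesis
    by (simp add: mono_grad_def mono_eval_def lookup_add lookup_single prod.remove[of UNIV i])
qed

text \<open>Differentiating in \<open>x $ i\<close> and multiplying by \<open>x $ j\<close> trades
  one factor of a monomial for another, so the degree does not grow.\<close>

lemma linear_field_derivative_in_poly_space:
  assumes "q \<in> poly_space d"
  obtains h where "h \<in> poly_space d" "\<And>x. poly_eval h x = x $ j * poly_grad q x $ i"
proof -
  have "\<exists>h. h \<in> poly_space d \<and> (\<forall>x. poly_eval h x = x $ j * (Poly_Mapping.lookup q m * mono_grad m x $ i))"
    if m: "m \<in> Poly_Mapping.keys q" for m
  proof (cases "Poly_Mapping.lookup m i")
    case 0
    then show ?thesis
      by (intro exI[of _ 0]) (simp add: poly_space_iff poly_eval_zero mono_grad_def)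
  next
    case (Suc k)
    \<comment> \<open>Subtraction of exponents is truncated, but here the exponent at
      \<open>i\<close> is positive, so \<open>m\<close> is recovered from \<open>m'\<close>.\<close>
    define m' where "m' = m - Poly_Mapping.single i 1"
    have mm: "m = m' + Poly_Mapping.single i 1"
      by (rule poly_mapping_eqI) (use Suc in \<open>auto simp: m'_def lookup_add lookup_minus lookup_single when_def\<close>)
    have deg: "mono_degree (m' + Poly_Mapping.single j 1) \<le> d"
      using bspec[OF assms[unfolded poly_space_def mem_Collect_eq] m]
      by (simp add: mm mono_degree_add mono_degree_single)
    let ?h = "Poly_Mapping.single (m' + Poly_Mapping.single j 1) (Poly_Mapping.lookup q m * Suc (Poly_Mapping.lookup m' i))"
    have "?h \<in> poly_space d" using deg by (auto simp: poly_space_iff lookup_single when_def)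
    moreover have "poly_eval ?h x = x $ j * (Poly_Mapping.lookup q m * mono_grad m x $ i)" for x
      unfolding poly_eval_single mono_eval_add mono_eval_single
      by (subst (2) mm) (simp only: mono_grad_eq mult_ac)
    ultimately show ?thesis by blast
  qed
  then obtain H where H: "\<And>m. m \<in> Poly_Mapping.keys q \<Longrightarrow> H m \<in> poly_space d"
    "\<And>m x. m \<in> Poly_Mapping.keys q \<Longrightarrow> poly_eval (H m) x = x $ j * (Poly_Mapping.lookup q m * mono_grad m x $ i)"
    by metis
  show thesis
  proof (rule that)
    show "sum H (Poly_Mapping.keys q) \<in> poly_space d" using H(1) by (rule poly_space_sum)
    show "poly_eval (sum H (Poly_Mapping.keys q)) x = x $ j * poly_grad q x $ i" for x
      by (simp add: poly_eval_sum H(2) poly_grad_def sum_distrib_left)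
  qed
qed

section \<open>Polynomials with algebraically independent coefficients\<close>

text \<open>Syntax trees for integer polynomials in countably many variables. Only countability and
  structural recursion are needed, so distinct trees may denote the same polynomial.\<close>

datatype int_expr = IConst int | IVar nat | IAdd int_expr int_expr | IMul int_expr int_expr

instance int_expr :: countable
  by countable_datatype

primrec ieval :: "int_expr \<Rightarrow> (nat \<Rightarrow> real) \<Rightarrow> real" where
  "ieval (IConst z) c = of_int z"
| "ieval (IVar k) c = c k"
| "ieval (IAdd e f) c = ieval e c + ieval f c"
| "ieval (IMul e f) c = ieval e c * ieval f c"

primrec ideriv :: "int_expr \<Rightarrow> (nat \<Rightarrow> real) \<Rightarrow> (nat \<Rightarrow> real) \<Rightarrow> real" where
  "ideriv (IConst z) c h = 0"
| "ideriv (IVar k) c h = h k"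
| "ideriv (IAdd e f) c h = ideriv e c h + ideriv f c h"
| "ideriv (IMul e f) c h = ieval e c * ideriv f c h + ideriv e c h * ieval f c"

lemma ieval_line_has_derivative:
  "((\<lambda>s. ieval e (\<lambda>k. c k + s * h k)) has_field_derivative ideriv e c h) (at 0)"
proof (induction e)
  case (IVar k)
  show ?case by (auto intro!: derivative_eq_intros)
next
  case (IAdd e f)
  then show ?case by (auto intro: DERIV_add)
next
  case (IMul e f)
  from DERIV_mult[OF this] show ?case by (simp add: mult_ac add_ac)
qed simp

lemma ieval_line_poly: "\<exists>p. \<forall>s. ieval e (\<lambda>k. c k + s * h k) = poly p s"
proof (induction e)
  case (IConst z)
  show ?case by (intro exI[of _ "[:of_int z:]"]) simp
next
  case (IVar k)
  show ?case by (intro exI[of _ "[:c k, h k:]"]) simp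
next
  case (IAdd e f)
  then show ?case by (auto simp flip: poly_add)
next
  case (IMul e f)
  then show ?case by (auto simp flip: poly_mult)
qed

lemma continuous_on_ieval:
  assumes "\<And>k. continuous_on A (\<lambda>a. g a k)"
  shows "continuous_on A (\<lambda>a. ieval e (g a))"
  by (induction e) (auto intro!: continuous_intros assms)

lemma countable_monomials: "countable (UNIV :: ('n::finite \<Rightarrow>\<^sub>0 nat) set)"
proof -
  have "inj (\<lambda>m :: 'n \<Rightarrow>\<^sub>0 nat. to_nat (Poly_Mapping.lookup m))"
    by (intro injI poly_mapping_eqI) (metis from_nat_to_nat)
  then show ?thesis by (rule countableI)
qed

definition coeff_seq :: "('n::finite) rpoly \<Rightarrow> nat \<Rightarrow> real" where
  "coeff_seq q k = Poly_Mapping.lookup q (from_nat_into UNIV k)"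

lemma lookup_eq_coeff_seq:
  "\<exists>k. \<forall>q. Poly_Mapping.lookup (q :: ('n::finite) rpoly) m = coeff_seq q k"
  using from_nat_into_surj[OF countable_monomials UNIV_I, of m] by (auto simp: coeff_seq_def)

text \<open>Coefficients of monomials of degree above \<open>d\<close> are always 0, so algebraic
  independence is stated relative to the relations valid on all of
  \<open>poly_space d\<close>.\<close>

definition generic_poly :: "nat \<Rightarrow> ('n::finite) rpoly \<Rightarrow> bool" where
  "generic_poly d q \<longleftrightarrow> q \<in> poly_space d \<and>
     (\<forall>e. ieval e (coeff_seq q) = 0 \<longrightarrow> (\<forall>p\<in>poly_space d. ieval e (coeff_seq (p :: 'n rpoly)) = 0))"

lemma poly_space_line:
  assumes "q \<in> poly_space d" "h \<in> poly_space d"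
  shows "q + Poly_Mapping.map ((*) s) h \<in> poly_space d"
  using assms by (fastforce simp: poly_space_iff lookup_add Poly_Mapping.map.rep_eq when_def)

lemma lookup_line:
  fixes q h :: "('n::finite) rpoly"
  shows "Poly_Mapping.lookup (q + Poly_Mapping.map ((*) s) h) m =
    Poly_Mapping.lookup q m + s * Poly_Mapping.lookup h m"
  by (simp add: lookup_add Poly_Mapping.map.rep_eq when_def)

lemma coeff_seq_line:
  "coeff_seq (q + Poly_Mapping.map ((*) s) h) = (\<lambda>k. coeff_seq q k + s * coeff_seq h k)"
  by (simp add: coeff_seq_def fun_eq_iff lookup_line)

text \<open>On the ring generated by the coefficients of \<open>q\<close>, the derivation is the
  directional derivative \<open>ideriv\<close> along \<open>h\<close>; genericity makes it well
  defined, and it then extends to all reals.\<close>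

lemma generic_poly_derivation:
  fixes q :: "('n::finite) rpoly"
  assumes q: "generic_poly d q" and h: "h \<in> poly_space d"
  obtains D where "derivation D" "\<And>m. D (Poly_Mapping.lookup q m) = Poly_Mapping.lookup h m"
proof -
  let ?c = "coeff_seq q" and ?h = "coeff_seq h"
  define G where "G = {(ieval e ?c, ideriv e ?c ?h) | e. True}"
  have mem: "(ieval e ?c, ideriv e ?c ?h) \<in> G" for e by (auto simp: G_def)
  have "derivation_graph G"
    unfolding derivation_graph_def
  proof (intro conjI allI impI)
    show "(1, 0) \<in> G" using mem[of "IConst 1"] by simp
  next
    fix a a' b b' assume "(a, a') \<in> G" "(b, b') \<in> G"
    then obtain e f where "a = ieval e ?c" "a' = ideriv e ?c ?h" "b = ieval f ?c" "b' = ideriv f ?c ?h"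
      by (auto simp: G_def)
    then show "(a - b, a' - b') \<in> G" "(a * b, a * b' + a' * b) \<in> G"
      using mem[of "IAdd e (IMul (IConst (-1)) f)"] mem[of "IMul e f"] by simp_all
  next
    fix b assume "(0, b) \<in> G"
    then obtain e where e: "ieval e ?c = 0" "b = ideriv e ?c ?h" by (auto simp: G_def)
    \<comment> \<open>An expression vanishing at \<open>q\<close> vanishes on all of
      \<open>poly_space d\<close>, hence on this line, where its derivative must be 0.\<close>
    have "ieval e (\<lambda>k. ?c k + s * ?h k) = 0" for s
      using q h e(1) poly_space_line[of q d h s]
      unfolding generic_poly_def coeff_seq_line[symmetric] by blast
    with ieval_line_has_derivative[of e ?c ?h] have "((\<lambda>s. 0) has_field_derivative b) (at (0::real))"
      by (simp add: e(2))
    then show "b = 0" using DERIV_unique DERIV_const by blast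
  qed
  then obtain D where D: "derivation D" "\<And>a b. (a, b) \<in> G \<Longrightarrow> D a = b"
    using derivation_graph_extends by blast
  have "D (Poly_Mapping.lookup q m) = Poly_Mapping.lookup h m" for m
  proof -
    obtain k where k: "\<And>p. Poly_Mapping.lookup (p :: 'n rpoly) m = coeff_seq p k" using lookup_eq_coeff_seq by blast
    show ?thesis using D(2)[OF mem[of "IVar k"]] by (simp add: k)
  qed
  with D(1) show thesis by (rule that)
qed

section \<open>Residuality of the generic polynomials\<close>

lemma residual_in_mono:
  assumes "S \<subseteq> T" "residual_in X S" "T \<subseteq> topspace X"
  shows "residual_in X T"
  using assms unfolding residual_in_def by (meson subset_trans)

text \<open>Each of the countably many expressions not vanishing identically excludes only a closed
  set with dense complement.\<close>

lemma generically_generic_poly: "generically d (generic_poly d :: ('n::finite) rpoly \<Rightarrow> bool)"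
proof -
  define E where "E = {e. \<exists>p\<in>poly_space d. ieval e (coeff_seq (p :: 'n rpoly)) \<noteq> 0}"
  define U where "U e = {q \<in> poly_space d. ieval e (coeff_seq (q :: 'n rpoly)) \<noteq> 0}" for e
  have "openin (poly_topology d) (U e)" for e
  proof -
    have "continuous_on UNIV (\<lambda>f :: ('n \<Rightarrow>\<^sub>0 nat) \<Rightarrow> real. ieval e (\<lambda>k. f (from_nat_into UNIV k)))"
      by (intro continuous_on_ieval continuous_on_product_coordinates)
    then have "open ((\<lambda>f :: ('n \<Rightarrow>\<^sub>0 nat) \<Rightarrow> real. ieval e (\<lambda>k. f (from_nat_into UNIV k))) -` (- {0}))"
      by (intro open_vimage) auto
    then show ?thesis
      unfolding poly_topology_def openin_pullback_topology open_openin[symmetric]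
      by (rule_tac exI, intro conjI, assumption) (auto simp: U_def coeff_seq_def[abs_def])
  qed
  moreover have "poly_topology d closure_of U e = topspace (poly_topology d)" if e: "e \<in> E" for e
  proof -
    obtain p where p: "p \<in> poly_space d" "ieval e (coeff_seq (p :: 'n rpoly)) \<noteq> 0"
      using e by (auto simp: E_def)
    have "\<exists>y\<in>U e. y \<in> W" if W: "q \<in> W" "openin (poly_topology d) W" and q: "q \<in> poly_space d" for q W
    proof -
      obtain V where V: "open V" "W = Poly_Mapping.lookup -` V \<inter> poly_space d"
        using W(2) unfolding poly_topology_def openin_pullback_topology open_openin[symmetric] by blast
      \<comment> \<open>The line \<open>l\<close> runs from \<open>q\<close> at parameter 0 to
        \<open>p\<close> at parameter 1, so \<open>e\<close> is not identically zero along
        it.\<close>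
      define h where "h = p + Poly_Mapping.map ((*) (-1)) q"
      define l where "l s = q + Poly_Mapping.map ((*) s) h" for s
      have l: "l s \<in> poly_space d" for s
        unfolding l_def h_def by (intro poly_space_line p q)
      have "l 1 = p" by (rule poly_mapping_eqI) (simp add: l_def h_def lookup_line)
      obtain P where P: "\<And>s. ieval e (coeff_seq (l s)) = poly P s"
        unfolding l_def coeff_seq_line using ieval_line_poly by blast
      have "P \<noteq> 0" using P[of 1] p(2) \<open>l 1 = p\<close> by auto
      then have fin: "finite {s. poly P s = 0}" by (rule poly_roots_finite)
      have "continuous_on UNIV (\<lambda>s. Poly_Mapping.lookup (l s))"
        unfolding l_def by (intro continuous_on_coordinatewise_then_product) (auto simp: lookup_line intro!: continuous_intros)
      then have "open ((\<lambda>s. Poly_Mapping.lookup (l s)) -` V)" using V(1) by (intro open_vimage) auto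
      moreover have "l 0 = q" by (rule poly_mapping_eqI) (simp add: l_def lookup_line)
      then have "0 \<in> (\<lambda>s. Poly_Mapping.lookup (l s)) -` V" using W(1) V(2) by auto
      \<comment> \<open>A nonempty open set of reals is infinite and so contains a parameter that is
        not one of the finitely many roots of \<open>P\<close>.\<close>
      ultimately have "infinite ((\<lambda>s. Poly_Mapping.lookup (l s)) -` V)"
        using finite_imp_not_open by blast
      then obtain s where "Poly_Mapping.lookup (l s) \<in> V" "poly P s \<noteq> 0"
        using fin by (metis (mono_tags, lifting) finite_subset mem_Collect_eq subsetI vimageE)
      then show ?thesis using V(2) l[of s] P[of s] by (intro bexI[of _ "l s"]) (auto simp: U_def)
    qed
    then show ?thesis by (auto simp: closure_of_def topspace_poly_topology)
  qed
  moreover have "countable (U ` E)" by simp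
  moreover have "poly_space d \<inter> \<Inter>(U ` E) \<subseteq> {q \<in> poly_space d. generic_poly d q}"
    by (auto simp: U_def E_def generic_poly_def)
  ultimately show ?thesis
    unfolding generically_def residual_in_def topspace_poly_topology by blast
qed

section \<open>Nearest points\<close>

text \<open>If \<open>g \<bullet> w\<close> were negative, a short step from \<open>y\<close> along
  \<open>w\<close> would enter the ball and make \<open>f\<close> negative there.\<close>

lemma level_set_nearest_gradient_pos:
  fixes f :: "'a::euclidean_space \<Rightarrow> real"
  assumes f: "(f has_derivative (\<lambda>v. g \<bullet> v)) (at y)" "f y = 0"
    and pos: "\<And>z. z \<in> ball x (dist x y) \<Longrightarrow> f z > 0"
    and w: "(y - x) \<bullet> w < 0"
  shows "g \<bullet> w \<ge> 0"
proof (rule ccontr)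
  assume "\<not> g \<bullet> w \<ge> 0"
  then have neg: "g \<bullet> w < 0" by simp
  have line: "((\<lambda>s. y + s *\<^sub>R w) has_vector_derivative w) (at 0)"
    by (auto intro!: derivative_eq_intros)
  have f': "(f has_derivative (\<lambda>v. g \<bullet> v)) (at (y + 0 *\<^sub>R w))" using f(1) by simp
  have "((\<lambda>s. f (y + s *\<^sub>R w)) has_field_derivative g \<bullet> w) (at 0)"
    using has_derivative_compose[OF line[unfolded has_vector_derivative_def] f']
    by (simp add: has_field_derivative_def mult.commute[of _ "g \<bullet> w"] o_def)
  from DERIV_neg_dec_right[OF this neg] f(2)
  obtain d1 where d1: "d1 > 0" "\<And>s. 0 < s \<Longrightarrow> s < d1 \<Longrightarrow> f (y + s *\<^sub>R w) < 0" by auto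
  have "((\<lambda>s. (y + s *\<^sub>R w - x) \<bullet> (y + s *\<^sub>R w - x)) has_field_derivative 2 * ((y - x) \<bullet> w)) (at 0)"
    unfolding has_field_derivative_def
    by (auto intro!: derivative_eq_intros simp: inner_commute fun_eq_iff algebra_simps)
  from DERIV_neg_dec_right[OF this] w
  obtain d2 where d2: "d2 > 0"
    "\<And>s. 0 < s \<Longrightarrow> s < d2 \<Longrightarrow> (y + s *\<^sub>R w - x) \<bullet> (y + s *\<^sub>R w - x) < (y - x) \<bullet> (y - x)" by auto
  define s where "s = min d1 d2 / 2"
  have s: "0 < s" "s < d1" "s < d2" using d1(1) d2(1) by (auto simp: s_def)
  have "norm (y + s *\<^sub>R w - x) < norm (y - x)"
    using d2(2)[OF s(1,3)] by (simp add: norm_lt)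
  then have "f (y + s *\<^sub>R w) > 0" by (intro pos) (simp add: dist_norm norm_minus_commute)
  with d1(2)[OF s(1,2)] show False by simp
qed

text \<open>A Lagrange multiplier rule. The open ball contains no zero of \<open>f\<close>, so by
  connectedness \<open>f\<close> has constant sign there, and the one-sided estimate applies to
  \<open>f\<close> or to \<open>- f\<close>.\<close>

lemma level_set_nearest_gradient:
  fixes f :: "'a::euclidean_space \<Rightarrow> real"
  assumes cont: "continuous_on UNIV f" and f: "(f has_derivative (\<lambda>v. g \<bullet> v)) (at y)" "f y = 0"
    and nearest: "\<And>z. f z = 0 \<Longrightarrow> dist x y \<le> dist x z"
    and g: "g \<noteq> 0" and v: "g \<bullet> v = 0"
  shows "(y - x) \<bullet> v = 0"
proof -
  have nz: "f z \<noteq> 0" if "z \<in> ball x (dist x y)" for z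
    using nearest[of z] that by auto
  have "connected (f ` ball x (dist x y))"
    by (intro connected_continuous_image continuous_on_subset[OF cont] connected_ball) auto
  then have sign: "(\<forall>z\<in>ball x (dist x y). f z > 0) \<or> (\<forall>z\<in>ball x (dist x y). - f z > 0)"
    using nz unfolding connected_iff_interval
    by (smt (verit) image_iff linorder_neqE_linordered_idom)
  have *: False if g': "g' \<noteq> 0" "g' \<bullet> v = 0" "\<And>w. (y - x) \<bullet> w < 0 \<Longrightarrow> g' \<bullet> w \<ge> 0"
    and nz: "(y - x) \<bullet> v \<noteq> 0" for g'
  proof -
    define a where "a = (y - x) \<bullet> v"
    define b where "b = (y - x) \<bullet> g'"
    \<comment> \<open>Small enough that adding \<open>- e *\<^sub>R g'\<close> to
      \<open>- a *\<^sub>R v\<close> keeps the inner product with \<open>y - x\<close> negative,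
      while the inner product with \<open>g'\<close> becomes negative too.\<close>
    define e where "e = a\<^sup>2 / (2 * (\<bar>b\<bar> + 1))"
    have "e > 0" using nz by (simp add: e_def a_def)
    have "\<bar>e * b\<bar> = a\<^sup>2 / 2 * (\<bar>b\<bar> / (\<bar>b\<bar> + 1))" by (simp add: e_def abs_mult)
    also have "\<dots> \<le> a\<^sup>2 / 2" by (intro mult_left_le) (auto simp: divide_le_eq)
    also have "\<dots> < a\<^sup>2" using nz by (simp add: a_def)
    finally have "(y - x) \<bullet> (- a *\<^sub>R v - e *\<^sub>R g') < 0"
      unfolding inner_diff_right inner_scaleR_right a_def[symmetric] b_def[symmetric] power2_eq_square
      by linarith
    then have "g' \<bullet> (- a *\<^sub>R v - e *\<^sub>R g') \<ge> 0" by (rule g'(3))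
    then have "e * (g' \<bullet> g') \<le> 0" by (simp add: inner_diff_right g'(2))
    moreover have "e * (g' \<bullet> g') > 0" using \<open>e > 0\<close> g'(1) by simp
    ultimately show False by linarith
  qed
  have f': "((\<lambda>z. - f z) has_derivative (\<lambda>v. - g \<bullet> v)) (at y)" "- f y = 0"
    using has_derivative_minus[OF f(1)] f(2) by simp_all
  from sign show ?thesis
  proof
    assume "\<forall>z\<in>ball x (dist x y). f z > 0"
    then show ?thesis using *[of g] g v level_set_nearest_gradient_pos[OF f] by blast
  next
    assume "\<forall>z\<in>ball x (dist x y). - f z > 0"
    then show ?thesis using *[of "- g"] g v level_set_nearest_gradient_pos[OF f'] by force
  qed
qed

section \<open>Affine independence from second moments\<close>

text \<open>Multiplying an affine dependence by an affine function vanishing at \<open>v\<close> but not at \<open>w\<close>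
  gives a dependence on fewer points.\<close>

lemma affine_independent_of_moments:
  fixes N :: "'a::euclidean_space set"
  assumes moments: "\<And>S u b. finite S \<Longrightarrow> S \<subseteq> N \<Longrightarrow> sum u S = 0 \<Longrightarrow> (\<Sum>y\<in>S. u y *\<^sub>R y) = 0 \<Longrightarrow>
    (\<Sum>y\<in>S. (u y * (y \<bullet> b)) *\<^sub>R y) = 0"
  shows "\<not> affine_dependent N"
proof -
  have "\<forall>w\<in>S. u w = 0"
    if "finite S" "S \<subseteq> N" "sum u S = 0" "(\<Sum>y\<in>S. u y *\<^sub>R y) = 0" for S and u :: "'a \<Rightarrow> real"
    using that
  proof (induction "card S" arbitrary: S u rule: less_induct)
    case less
    show ?case
    proof
      fix w assume w: "w \<in> S"
      show "u w = 0"
      proof (cases "S = {w}")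
        case True
        then show ?thesis using less.prems(3) by simp
      next
        case False
        then obtain v where v: "v \<in> S" "v \<noteq> w" using w by blast
        define b where "b = w - v"
        \<comment> \<open>The weight is multiplied by \<open>(y - v) \<bullet> b\<close>, which is 0
          at \<open>v\<close> and \<open>b \<bullet> b\<close> at \<open>w\<close>.\<close>
        define u' where "u' y = u y * (y \<bullet> b) - (v \<bullet> b) * u y" for y
        have "(\<Sum>y\<in>S. u y * (y \<bullet> b)) = (\<Sum>y\<in>S. u y *\<^sub>R y) \<bullet> b"
          by (simp add: inner_sum_left)
        then have "sum u' S = 0"
          using less.prems(3,4) by (simp add: u'_def sum_subtractf flip: sum_distrib_left)
        moreover have "(\<Sum>y\<in>S. u' y *\<^sub>R y) = 0"
          using moments[OF less.prems, of b] less.prems(4)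
          by (simp add: u'_def scaleR_left_diff_distrib sum_subtractf flip: scaleR_scaleR scaleR_sum_right)
        moreover have "u' v = 0" by (simp add: u'_def)
        ultimately have "sum u' (S - {v}) = 0" "(\<Sum>y\<in>S - {v}. u' y *\<^sub>R y) = 0"
          using v(1) less.prems(1) by (simp_all add: sum_diff1)
        moreover have "card (S - {v}) < card S" using v(1) less.prems(1) by (meson card_Diff1_less)
        ultimately have "u' w = 0"
          using less.hyps[of "S - {v}" u'] less.prems(1,2) v w by blast
        then have "u w * (b \<bullet> b) = 0"
          by (simp add: u'_def b_def algebra_simps)
        then show ?thesis using v(2) by (simp add: b_def)
      qed
    qed
  qed
  then show ?thesis unfolding affine_dependent_explicit by blast
qed

text \<open>With zero gradient, applying the derivation for \<open>h = 1\<close> to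
  \<open>poly_eval q y = 0\<close> would give \<open>1 = 0\<close>.\<close>

lemma generic_poly_grad_nonzero:
  fixes q :: "('n::finite) rpoly"
  assumes "generic_poly d q" "poly_eval q y = 0"
  shows "poly_grad q y \<noteq> 0"
proof
  assume "poly_grad q y = 0"
  let ?h = "Poly_Mapping.single 0 1 :: 'n rpoly"
  have "?h \<in> poly_space d" by (auto simp: poly_space_iff lookup_one when_def mono_degree_def)
  then obtain D where D: "derivation D" "\<And>m. D (Poly_Mapping.lookup q m) = Poly_Mapping.lookup ?h m"
    using generic_poly_derivation[OF assms(1)] by blast
  moreover have "poly_eval ?h y = 1"
    by (subst poly_eval_single) (simp add: mono_eval_def)
  ultimately show False
    using derivation_poly_eval[OF D, of y] assms(2) \<open>poly_grad q y = 0\<close>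
    by (simp add: derivation_0[OF D(1)])
qed

text \<open>The case in which \<open>B\<close> sends \<open>z\<close> to
  \<open>z $ j *\<^sub>R axis i 1\<close>, so that the quadratic form becomes
  \<open>(y - x) $ i * y $ j\<close>.\<close>

lemma generic_poly_nearest_moments:
  fixes q :: "('n::finite) rpoly"
  assumes q: "generic_poly d q"
    and N: "\<And>y. y \<in> N \<Longrightarrow> poly_eval q y = 0" "\<And>y. y \<in> N \<Longrightarrow> dist x y = r"
    and nearest: "\<And>z. poly_eval q z = 0 \<Longrightarrow> r \<le> dist x z"
    and u: "finite S" "S \<subseteq> N" "sum u S = 0" "(\<Sum>y\<in>S. u y *\<^sub>R y) = 0"
  shows "(\<Sum>y\<in>S. u y * (y $ i * y $ j)) = 0"
proof -
  obtain h where h: "h \<in> poly_space d" "\<And>x. poly_eval h x = x $ j * poly_grad q x $ i"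
    using linear_field_derivative_in_poly_space q unfolding generic_poly_def by blast
  obtain D where D: "derivation D" "\<And>m. D (Poly_Mapping.lookup q m) = Poly_Mapping.lookup h m"
    using generic_poly_derivation[OF q h(1)] by blast
  define \<delta> where "\<delta> y = (\<chi> k. D (y $ k))" for y :: "real ^ 'n"
  \<comment> \<open>Neither \<open>\<delta> x\<close> nor \<open>D (r\<^sup>2)\<close> depends on
    \<open>y\<close>, so the right-hand side is affine in \<open>y\<close>.\<close>
  have "(y - x) $ i * y $ j = (y - x) \<bullet> - \<delta> x - D (r\<^sup>2) / 2" if y: "y \<in> N" for y
  proof -
    \<comment> \<open>By the choice of \<open>h\<close>, its value at \<open>y\<close> is the inner
      product of the gradient with \<open>y $ j *\<^sub>R axis i 1\<close>.\<close>
    have "poly_grad q y \<bullet> (\<delta> y + y $ j *\<^sub>R axis i 1) = 0"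
      using derivation_poly_eval[OF D, of y] N(1)[OF y]
      by (simp add: derivation_0[OF D(1)] h(2) \<delta>_def inner_add_right inner_axis)
    then have "(y - x) \<bullet> (\<delta> y + y $ j *\<^sub>R axis i 1) = 0"
      using N y nearest
      by (intro level_set_nearest_gradient[OF _ poly_eval_has_derivative[of q y]]
           generic_poly_grad_nonzero[OF q])
         (auto intro!: has_derivative_continuous_on[OF poly_eval_has_derivative])
    then have 1: "(y - x) \<bullet> \<delta> y + (y - x) $ i * y $ j = 0"
      by (simp add: inner_add_right inner_axis mult.commute)
    \<comment> \<open>Differentiating the squared distance trades the uncontrolled
      \<open>\<delta> y\<close> for \<open>\<delta> x\<close> and
      \<open>D (r\<^sup>2)\<close>.\<close>
    have r: "r\<^sup>2 = (\<Sum>k\<in>UNIV. (y $ k - x $ k)\<^sup>2)"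
      using N(2)[OF y]
      by (simp add: dist_vec_def L2_set_def dist_real_def sum_nonneg power2_commute flip: N(2)[OF y])
    have "D (r\<^sup>2) = (\<Sum>k\<in>UNIV. of_nat 2 * (y $ k - x $ k) ^ (2 - 1) * (D (y $ k) - D (x $ k)))"
      by (simp only: r derivation_sum[OF D(1)] derivation_power[OF D(1)] derivation_diff[OF D(1)])
    also have "\<dots> = 2 * ((y - x) \<bullet> (\<delta> y - \<delta> x))"
      unfolding inner_vec_def sum_distrib_left by (intro sum.cong) (simp_all add: \<delta>_def)
    finally have "D (r\<^sup>2) = 2 * ((y - x) \<bullet> (\<delta> y - \<delta> x))" .
    moreover have "p = - b - c / 2" if "a + p = 0" "c = 2 * (a - b)" for a b c p :: real
      using that by argo
    ultimately show ?thesis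
      using 1 unfolding inner_diff_right inner_minus_right by blast
  qed
  then have affine: "y $ i * y $ j = x $ i * y $ j - y \<bullet> \<delta> x + (x \<bullet> \<delta> x - D (r\<^sup>2) / 2)" if "y \<in> N" for y
    using that by (simp add: algebra_simps)
  have "(\<Sum>y\<in>S. u y * (y $ i * y $ j)) =
      (\<Sum>y\<in>S. x $ i * (u y * y $ j) - u y * (y \<bullet> \<delta> x) + (x \<bullet> \<delta> x - D (r\<^sup>2) / 2) * u y)"
  proof (intro sum.cong refl)
    fix y assume "y \<in> S"
    then have "y \<in> N" using u(2) by blast
    show "u y * (y $ i * y $ j) =
        x $ i * (u y * y $ j) - u y * (y \<bullet> \<delta> x) + (x \<bullet> \<delta> x - D (r\<^sup>2) / 2) * u y"
      unfolding affine[OF \<open>y \<in> N\<close>] by (simp add: algebra_simps)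
  qed
  also have "\<dots> = x $ i * (\<Sum>y\<in>S. u y *\<^sub>R y) $ j - (\<Sum>y\<in>S. u y *\<^sub>R y) \<bullet> \<delta> x
      + (x \<bullet> \<delta> x - D (r\<^sup>2) / 2) * sum u S"
    by (simp add: sum.distrib sum_subtractf sum_distrib_left inner_sum_left)
  also have "\<dots> = 0" by (simp add: u)
  finally show ?thesis .
qed

text \<open>Expanding \<open>y \<bullet> b\<close> in coordinates reduces the moment condition to
  the vanishing sums of \<open>y $ i * y $ j\<close>.\<close>

lemma generic_poly_nearest_points_independent:
  fixes q :: "('n::finite) rpoly"
  assumes q: "generic_poly d q" and "zero_set q \<noteq> {}"
  shows "\<not> affine_dependent (nearest_points (zero_set q) x)"
proof (rule affine_independent_of_moments)
  let ?N = "nearest_points (zero_set q) x" and ?r = "infdist x (zero_set q)"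
  have near: "?r \<le> dist x z" if "poly_eval q z = 0" for z
    using that by (intro infdist_le) (simp add: zero_set_def)
  have N: "poly_eval q y = 0" "dist x y = ?r" if "y \<in> ?N" for y
    using that near[of y] by (auto simp: nearest_points_def zero_set_def)
  fix S u and b :: "real ^ 'n"
  assume S: "finite S" "S \<subseteq> ?N" "sum u S = 0" "(\<Sum>y\<in>S. u y *\<^sub>R y) = 0"
  have "(\<Sum>y\<in>S. u y * (y \<bullet> b) * y $ i) = (\<Sum>j\<in>UNIV. b $ j * (\<Sum>y\<in>S. u y * (y $ i * y $ j)))" for i
    unfolding inner_vec_def sum_distrib_left sum_distrib_right
    by (subst sum.swap) (simp add: mult_ac)
  then show "(\<Sum>y\<in>S. (u y * (y \<bullet> b)) *\<^sub>R y) = 0"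
    using generic_poly_nearest_moments[OF q N near S] by (simp add: vec_eq_iff)
qed

theorem theorem1p4p1:
  fixes d :: nat
  assumes "d \<ge> 2"
  shows "generically d (\<lambda>q :: ('n::finite) rpoly.
           zero_set q \<noteq> {} \<longrightarrow>
           (\<forall>x. finite (nearest_points (zero_set q) x) \<and>
                \<not> affine_dependent (nearest_points (zero_set q) x) \<and>
                num_nearest (zero_set q) x \<le> CARD('n) + 1))"
proof -
  \<comment> \<open>Affine independence alone yields finiteness and the bound by dimension plus
    one.\<close>
  have independent: "finite N \<and> \<not> affine_dependent N \<and> card N \<le> CARD('n) + 1"
    if "\<not> affine_dependent N" for N :: "(real ^ 'n) set"
    using that aff_independent_finite[OF that] affine_dependent_biggerset[of N] by fastforce
  have "finite (nearest_points (zero_set q) x) \<and>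
      \<not> affine_dependent (nearest_points (zero_set q) x) \<and>
      num_nearest (zero_set q) x \<le> CARD('n) + 1"
    if "generic_poly d q" "zero_set q \<noteq> {}" for q :: "'n rpoly" and x
    unfolding num_nearest_def by (rule independent) (rule generic_poly_nearest_points_independent[OF that])
  then have "{q \<in> poly_space d. generic_poly d q} \<subseteq> {q \<in> poly_space d :: 'n rpoly set. zero_set q \<noteq> {} \<longrightarrow>
      (\<forall>x. finite (nearest_points (zero_set q) x) \<and>
           \<not> affine_dependent (nearest_points (zero_set q) x) \<and>
           num_nearest (zero_set q) x \<le> CARD('n) + 1)}"
    by blast
  moreover have "residual_in (poly_topology d) {q \<in> poly_space d. generic_poly d (q :: 'n rpoly)}"
    using generically_generic_poly unfolding generically_def .
  ultimately show ?thesis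
    unfolding generically_def by (rule residual_in_mono) (auto simp: topspace_poly_topology)
qed

end
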